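(* Let $(R,H)$ be a pair of functors $\mathcal V\to\mathsf{Ab}$ satisfying conditions (R1), (R2), (H1), (H2) recalled in the context, and let $p$ be a prime number. Assume that two complete varieties $Y,X\in\mathsf{Reg}$ are $p$-equivalent. Then, as subgroups of $H(k)\otimes\mathbb Z_{(p)}$, we have $$H_Y(k)\otimes\mathbb Z_{(p)}=H_X(k)\otimes\mathbb Z_{(p)}.$$
   Context: $k$ is a fixed base field. A variety is an integral, separated scheme of finite type over $\operatorname{Spec}k$; complete means proper over $k$. $\mathsf{Ab}$ is the category of abelian groups. $\mathcal V$ is a full subcategory of the category of varieties and proper morphisms, with $\operatorname{Spec}k\in\mathcal V$; $\mathsf{Reg}$ is the full subcategory of $\mathcal V$ consisting of the regular varieties in $\mathcal V$ (or, alternatively, of the smooth varieties in $\mathcal V$). $R,H\colon\mathcal V\to\mathsf{Ab}$ are covariant functors; for a morphism $f$ of $\mathcal V$, $f_*$ denotes either induced map. Conditions: for all $X\in\mathcal V$, $S\in\mathsf{Reg}$, and every proper, dominant, generically finite morphism $f\colon X\to S$ of degree $d=[k(X):k(S)]$, (R1) the group $R(S)$ has a structure of an associative ring with unit $1_S$; (R2) there is $u\in R(X)$ such that $f_*u-d\cdot 1_S$ is nilpotent in the ring $R(S)$; (H1) there is a morphism of abelian groups $R(X)\otimes H(S)\to H(X)$, $x\otimes s\mapsto x\cdot_f s$; (H2) the group $H(S)$ has a structure of a left $R(S)$-module such that $f_*(x\cdot_f s)=(f_*x)\cdot s$ for all $x\in R(X)$, $s\in H(S)$. For a complete $X\in\mathcal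 V$ with structural morphism $x\colon X\to\operatorname{Spec}k$, put $H_X(k)=\operatorname{im}(x_*\colon H(X)\to H(k))\subset H(k)$, where $H(k)=H(\operatorname{Spec}k)$. $\mathbb Z_{(p)}\subset\mathbb Q$ is the subgroup of fractions with denominator prime to $p$. A correspondence $Y\leadsto X$ is a diagram of varieties and proper morphisms $Y\leftarrow Z\to X$, where $Z\to Y$ is dominant and generically finite; its multiplicity is the degree of $Z\to Y$. Two varieties $X$ and $Y$ are $p$-equivalent if there are correspondences $Y\leadsto X$ and $X\leadsto Y$ of multiplicities prime to $p$.
   Formalization: The middle variety Z of each correspondence in the p-equivalence is required to belong to 𝒱; for arbitrary Z outside 𝒱 the claim fails (e.g. 𝒱 consisting of Spec k and two pointless genus one curves with non-isogenous Jacobians). *)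

theory Defs
  imports
    "HOL-Analysis.Abstract_Topology"
    "HOL-Algebra.Embedded_Algebras"
    "HOL-Algebra.Generated_Rings"
    "HOL-Algebra.Ring_Divisibility"
    "HOL-Algebra.Free_Abelian_Groups"
    "HOL-Computational_Algebra.Primes"
begin

section \<open>Locally ringed spaces\<close>

record ('a, 'b) ringed_space =
  pts :: "'a topology"
  sect :: "'a set \<Rightarrow> 'b ring"
  res :: "'a set \<Rightarrow> 'a set \<Rightarrow> 'b \<Rightarrow> 'b" \<comment> \<open>\<open>res X U V\<close> restricts from \<open>U\<close> to \<open>V \<subseteq> U\<close>\<close>

abbreviation opn :: "('a, 'b) ringed_space \<Rightarrow> 'a set \<Rightarrow> bool"
  where "opn X \<equiv> openin (pts X)"

abbreviation pt_set :: "('a, 'b) ringed_space \<Rightarrow> 'a set"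
  where "pt_set X \<equiv> topspace (pts X)"

definition presheaf_of_rings :: "('a, 'b) ringed_space \<Rightarrow> bool"
  where "presheaf_of_rings X \<longleftrightarrow>
    (\<forall>U. opn X U \<longrightarrow> cring (sect X U)) \<and>
    (\<forall>U V. opn X U \<and> opn X V \<and> V \<subseteq> U \<longrightarrow> res X U V \<in> ring_hom (sect X U) (sect X V)) \<and>
    (\<forall>U. opn X U \<longrightarrow> (\<forall>s \<in> carrier (sect X U). res X U U s = s)) \<and>
    (\<forall>U V W. opn X U \<and> opn X V \<and> opn X W \<and> W \<subseteq> V \<and> V \<subseteq> U \<longrightarrow>
       (\<forall>s \<in> carrier (sect X U). res X V W (res X U V s) = res X U W s))"

definition ringed_space :: "('a, 'b) ringed_space \<Rightarrow> bool"
  where "ringed_space X \<longleftrightarrow> presheaf_of_rings X \<and>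
    (\<forall>C. (\<forall>U \<in> C. opn X U) \<longrightarrow>
       (\<forall>s \<in> carrier (sect X (\<Union>C)). \<forall>t \<in> carrier (sect X (\<Union>C)).
          (\<forall>U \<in> C. res X (\<Union>C) U s = res X (\<Union>C) U t) \<longrightarrow> s = t) \<and>
       (\<forall>\<phi>. (\<forall>U \<in> C. \<phi> U \<in> carrier (sect X U)) \<and>
            (\<forall>U \<in> C. \<forall>V \<in> C. res X U (U \<inter> V) (\<phi> U) = res X V (U \<inter> V) (\<phi> V)) \<longrightarrow>
            (\<exists>s \<in> carrier (sect X (\<Union>C)). \<forall>U \<in> C. res X (\<Union>C) U s = \<phi> U)))"

text \<open>A germ is the class of all pairs (neighbourhood, section) agreeing near the point.\<close>

definition germ :: "('a, 'b) ringed_space \<Rightarrow> 'a \<Rightarrow> 'a set \<Rightarrow> 'b \<Rightarrow> ('a set \<times> 'b) set"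
  where "germ X x U s =
    {(V, t). opn X V \<and> x \<in> V \<and> t \<in> carrier (sect X V) \<and>
             (\<exists>W. opn X W \<and> x \<in> W \<and> W \<subseteq> U \<inter> V \<and> res X U W s = res X V W t)}"

definition stalk :: "('a, 'b) ringed_space \<Rightarrow> 'a \<Rightarrow> ('a set \<times> 'b) set ring"
  where "stalk X x =
    \<lparr>carrier = {germ X x U s | U s. opn X U \<and> x \<in> U \<and> s \<in> carrier (sect X U)},
     monoid.mult = (\<lambda>a b. \<Union>(U, s)\<in>a. \<Union>(V, t)\<in>b.
       germ X x (U \<inter> V) (res X U (U \<inter> V) s \<otimes>\<^bsub>sect X (U \<inter> V)\<^esub> res X V (U \<inter> V) t)),
     monoid.one = germ X x (pt_set X) \<one>\<^bsub>sect X (pt_set X)\<^esub>,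
     ring.zero = germ X x (pt_set X) \<zero>\<^bsub>sect X (pt_set X)\<^esub>,
     ring.add = (\<lambda>a b. \<Union>(U, s)\<in>a. \<Union>(V, t)\<in>b.
       germ X x (U \<inter> V) (res X U (U \<inter> V) s \<oplus>\<^bsub>sect X (U \<inter> V)\<^esub> res X V (U \<inter> V) t))\<rparr>"

definition local_ring :: "('a, 'm) ring_scheme \<Rightarrow> bool"
  where "local_ring A \<longleftrightarrow> cring A \<and> (\<exists>!m. maximalideal m A)"

definition max_ideal :: "('a, 'm) ring_scheme \<Rightarrow> 'a set"
  where "max_ideal A = (THE m. maximalideal m A)"

definition locally_ringed_space :: "('a, 'b) ringed_space \<Rightarrow> bool"
  where "locally_ringed_space X \<longleftrightarrow> ringed_space X \<and> (\<forall>x \<in> pt_set X. local_ring (stalk X x))"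

definition open_subspace :: "('a, 'b) ringed_space \<Rightarrow> 'a set \<Rightarrow> ('a, 'b) ringed_space"
  where "open_subspace X U = X\<lparr>pts := subtopology (pts X) U\<rparr>"

text \<open>In a morphism \<open>f : X \<rightarrow> Y\<close>, the map \<open>sh f V\<close> goes from the sections of \<open>Y\<close> over \<open>V\<close> to
  the sections of \<open>X\<close> over the preimage of \<open>V\<close>. All component maps are normalised to be
  \<open>undefined\<close> outside their domains, so that equality of morphisms is equality in HOL.\<close>

record ('a, 'b, 'c, 'd) morphism =
  pt :: "'a \<Rightarrow> 'c"
  sh :: "'c set \<Rightarrow> 'd \<Rightarrow> 'b"

definition preim :: "('a, 'b) ringed_space \<Rightarrow> ('a, 'b, 'c, 'd) morphism \<Rightarrow> 'c set \<Rightarrow> 'a set"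
  where "preim X f V = {x \<in> pt_set X. pt f x \<in> V}"

definition id_mor :: "('a, 'b) ringed_space \<Rightarrow> ('a, 'b, 'a, 'b) morphism"
  where "id_mor X = \<lparr>pt = restrict (\<lambda>x. x) (pt_set X),
    sh = (\<lambda>V. if opn X V then restrict (\<lambda>s. s) (carrier (sect X V)) else (\<lambda>_. undefined))\<rparr>"

definition comp_mor :: "('a, 'b) ringed_space \<Rightarrow> ('c, 'd) ringed_space \<Rightarrow> ('e, 'g) ringed_space \<Rightarrow>
    ('c, 'd, 'e, 'g) morphism \<Rightarrow> ('a, 'b, 'c, 'd) morphism \<Rightarrow> ('a, 'b, 'e, 'g) morphism"
  where "comp_mor X Y Z g f = \<lparr>pt = restrict (\<lambda>x. pt g (pt f x)) (pt_set X),
    sh = (\<lambda>W. if opn Z W then restrict (\<lambda>s. sh f (preim Y g W) (sh g W s)) (carrier (sect Z W))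
              else (\<lambda>_. undefined))\<rparr>"

definition stalk_map :: "('a, 'b) ringed_space \<Rightarrow> ('a, 'b, 'c, 'd) morphism \<Rightarrow> 'a \<Rightarrow>
    ('c set \<times> 'd) set \<Rightarrow> ('a set \<times> 'b) set"
  where "stalk_map X f x c = (\<Union>(V, s)\<in>c. germ X x (preim X f V) (sh f V s))"

definition is_morphism :: "('a, 'b) ringed_space \<Rightarrow> ('c, 'd) ringed_space \<Rightarrow>
    ('a, 'b, 'c, 'd) morphism \<Rightarrow> bool"
  where "is_morphism X Y f \<longleftrightarrow>
    pt f \<in> extensional (pt_set X) \<and>
    (\<forall>V. if opn Y V then sh f V \<in> extensional (carrier (sect Y V)) else sh f V = (\<lambda>_. undefined)) \<and>
    continuous_map (pts X) (pts Y) (pt f) \<and>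
    (\<forall>V. opn Y V \<longrightarrow> sh f V \<in> ring_hom (sect Y V) (sect X (preim X f V))) \<and>
    (\<forall>V W. opn Y V \<and> opn Y W \<and> W \<subseteq> V \<longrightarrow>
       (\<forall>s \<in> carrier (sect Y V).
          sh f W (res Y V W s) = res X (preim X f V) (preim X f W) (sh f V s))) \<and>
    (\<forall>x \<in> pt_set X. {c \<in> carrier (stalk Y (pt f x)). stalk_map X f x c \<in> max_ideal (stalk X x)}
       = max_ideal (stalk Y (pt f x)))"

definition isomorphic :: "('a, 'b) ringed_space \<Rightarrow> ('c, 'd) ringed_space \<Rightarrow> bool"
  where "isomorphic X Y \<longleftrightarrow> (\<exists>f g. is_morphism X Y f \<and> is_morphism Y X g \<and>
    comp_mor X Y X g f = id_mor X \<and> comp_mor Y X Y f g = id_mor Y)"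


section \<open>Schemes\<close>

text \<open>\<open>loc_frac A P a f\<close> is the element \<open>a / f\<close> of the localisation of \<open>A\<close> at the prime \<open>P\<close>,
  as an equivalence class of pairs (numerator, denominator).\<close>

definition loc_frac :: "('a, 'm) ring_scheme \<Rightarrow> 'a set \<Rightarrow> 'a \<Rightarrow> 'a \<Rightarrow> ('a \<times> 'a) set"
  where "loc_frac A P a f = {(b, g). b \<in> carrier A \<and> g \<in> carrier A - P \<and>
    (\<exists>t \<in> carrier A - P. t \<otimes>\<^bsub>A\<^esub> (a \<otimes>\<^bsub>A\<^esub> g \<ominus>\<^bsub>A\<^esub> b \<otimes>\<^bsub>A\<^esub> f) = \<zero>\<^bsub>A\<^esub>)}"

definition Zariski :: "('a, 'm) ring_scheme \<Rightarrow> 'a set topology"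
  where "Zariski A = topology_generated_by {{P. primeideal P A \<and> f \<notin> P} | f. f \<in> carrier A}"

text \<open>Sections over \<open>U\<close> are the families of elements of the localisations at the primes in \<open>U\<close>
  that are locally given by fractions.\<close>

definition Spec_sections :: "('a, 'm) ring_scheme \<Rightarrow> 'a set set \<Rightarrow> ('a set \<Rightarrow> ('a \<times> 'a) set) ring"
  where "Spec_sections A U =
    \<lparr>carrier = {s \<in> extensional U. \<forall>P \<in> U. \<exists>W. openin (Zariski A) W \<and> P \<in> W \<and> W \<subseteq> U \<and>
       (\<exists>a \<in> carrier A. \<exists>f \<in> carrier A. \<forall>Q \<in> W. f \<notin> Q \<and> s Q = loc_frac A Q a f)},
     monoid.mult = (\<lambda>s t. \<lambda>P\<in>U. \<Union>(a, f)\<in>s P. \<Union>(b, g)\<in>t P. loc_frac A P (a \<otimes>\<^bsub>A\<^esub> b) (f \<otimes>\<^bsub>A\<^esub> g)),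
     monoid.one = (\<lambda>P\<in>U. loc_frac A P \<one>\<^bsub>A\<^esub> \<one>\<^bsub>A\<^esub>),
     ring.zero = (\<lambda>P\<in>U. loc_frac A P \<zero>\<^bsub>A\<^esub> \<one>\<^bsub>A\<^esub>),
     ring.add = (\<lambda>s t. \<lambda>P\<in>U. \<Union>(a, f)\<in>s P. \<Union>(b, g)\<in>t P.
              loc_frac A P (a \<otimes>\<^bsub>A\<^esub> g \<oplus>\<^bsub>A\<^esub> b \<otimes>\<^bsub>A\<^esub> f) (f \<otimes>\<^bsub>A\<^esub> g))\<rparr>"

definition Spec :: "('a, 'm) ring_scheme \<Rightarrow> ('a set, 'a set \<Rightarrow> ('a \<times> 'a) set) ringed_space"
  where "Spec A = \<lparr>pts = Zariski A, sect = Spec_sections A, res = (\<lambda>U V s. restrict s V)\<rparr>"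

text \<open>Restricting \<open>A\<close> to rings on the type of sections loses nothing, since \<open>A\<close> is isomorphic to
  the ring of global sections.\<close>

definition affine_scheme :: "('a, 'b) ringed_space \<Rightarrow> bool"
  where "affine_scheme X \<longleftrightarrow> locally_ringed_space X \<and> (\<exists>A :: 'b ring. cring A \<and> isomorphic X (Spec A))"

definition affine_open :: "('a, 'b) ringed_space \<Rightarrow> 'a set \<Rightarrow> bool"
  where "affine_open X U \<longleftrightarrow> opn X U \<and> affine_scheme (open_subspace X U)"

definition scheme :: "('a, 'b) ringed_space \<Rightarrow> bool"
  where "scheme X \<longleftrightarrow> locally_ringed_space X \<and> (\<forall>x \<in> pt_set X. \<exists>U. affine_open X U \<and> x \<in> U)"

definition integral_scheme :: "('a, 'b) ringed_space \<Rightarrow> bool"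
  where "integral_scheme X \<longleftrightarrow> scheme X \<and> pt_set X \<noteq> {} \<and>
    (\<forall>U. opn X U \<and> U \<noteq> {} \<longrightarrow> domain (sect X U))"


section \<open>Proper morphisms\<close>

text \<open>From here on, points and sections of all schemes are taken from one type \<open>'u\<close>, which plays
  the role of a universe: fibre products are characterised by their universal property, tested
  on all schemes in \<open>'u\<close>. Schemes of finite type over a field \<open>k\<close> have, up to isomorphism, their
  points and sections in \<open>'u\<close> as soon as \<open>'u\<close> is infinite and contains \<open>k\<close>; so fibre products of
  such schemes exist in \<open>'u\<close>, and they suffice to test the properties below.\<close>

type_synonym 'u space = "('u, 'u) ringed_space"
type_synonym 'u mor = "('u, 'u, 'u, 'u) morphism"

definition is_fibre_product :: "'u space \<Rightarrow> 'u space \<Rightarrow> 'u space \<Rightarrow> 'u mor \<Rightarrow> 'u mor \<Rightarrow>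
    'u space \<Rightarrow> 'u mor \<Rightarrow> 'u mor \<Rightarrow> bool"
  \<comment> \<open>\<open>P\<close> with projections \<open>q\<close>, \<open>r\<close> is the fibre product of \<open>f : X \<rightarrow> S\<close> and \<open>g : Y \<rightarrow> S\<close>\<close>
  where "is_fibre_product X Y S f g P q r \<longleftrightarrow>
    scheme P \<and> is_morphism P X q \<and> is_morphism P Y r \<and> comp_mor P X S f q = comp_mor P Y S g r \<and>
    (\<forall>(T :: 'u space) a b. scheme T \<and> is_morphism T X a \<and> is_morphism T Y b \<and>
       comp_mor T X S f a = comp_mor T Y S g b \<longrightarrow>
       (\<exists>!h. is_morphism T P h \<and> comp_mor T P X q h = a \<and> comp_mor T P Y r h = b))"

definition closed_immersion :: "'u space \<Rightarrow> 'u space \<Rightarrow> 'u mor \<Rightarrow> bool"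
  where "closed_immersion X Y f \<longleftrightarrow> is_morphism X Y f \<and>
    embedding_map (pts X) (pts Y) (pt f) \<and> closedin (pts Y) (pt f ` pt_set X) \<and>
    (\<forall>x \<in> pt_set X. stalk_map X f x ` carrier (stalk Y (pt f x)) = carrier (stalk X x))"

definition separated :: "'u space \<Rightarrow> 'u space \<Rightarrow> 'u mor \<Rightarrow> bool"
  where "separated X S f \<longleftrightarrow> (\<exists>P q r \<delta>. is_fibre_product X X S f f P q r \<and> is_morphism X P \<delta> \<and>
    comp_mor X P X q \<delta> = id_mor X \<and> comp_mor X P X r \<delta> = id_mor X \<and> closed_immersion X P \<delta>)"

definition universally_closed :: "'u space \<Rightarrow> 'u space \<Rightarrow> 'u mor \<Rightarrow> bool"
  where "universally_closed X S f \<longleftrightarrow> (\<forall>T g P q r. scheme T \<and> is_morphism T S g \<and>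
    is_fibre_product X T S f g P q r \<longrightarrow> closed_map (pts P) (pts T) (pt r))"

definition finite_type :: "'u space \<Rightarrow> 'u space \<Rightarrow> 'u mor \<Rightarrow> bool"
  where "finite_type X S f \<longleftrightarrow> (\<forall>s \<in> pt_set S. \<exists>V. affine_open S V \<and> s \<in> V \<and>
    (\<exists>C. finite C \<and> \<Union>C = preim X f V \<and> (\<forall>U \<in> C. affine_open X U \<and>
       (\<exists>F \<subseteq> carrier (sect X U). finite F \<and>
          generate_ring (sect X U) (res X (preim X f V) U ` sh f V ` carrier (sect S V) \<union> F)
            = carrier (sect X U)))))"

definition proper :: "'u space \<Rightarrow> 'u space \<Rightarrow> 'u mor \<Rightarrow> bool"
  where "proper X S f \<longleftrightarrow> is_morphism X S f \<and>
    separated X S f \<and> finite_type X S f \<and> universally_closed X S f"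


section \<open>Varieties\<close>

text \<open>Schemes over a base \<open>K\<close>; below \<open>K\<close> is a copy in \<open>'u\<close> of the spectrum of the base field.\<close>

record 'u scheme_over =
  sch :: "'u space"
  str :: "'u mor"

abbreviation base :: "'u space \<Rightarrow> 'u scheme_over"
  where "base K \<equiv> \<lparr>sch = K, str = id_mor K\<rparr>"

definition is_Spec_field :: "'u ring \<Rightarrow> 'u space \<Rightarrow> bool"
  where "is_Spec_field k K \<longleftrightarrow> field k \<and> locally_ringed_space K \<and> isomorphic K (Spec k)"

definition variety :: "'u space \<Rightarrow> 'u scheme_over \<Rightarrow> bool"
  where "variety K X \<longleftrightarrow> integral_scheme (sch X) \<and> is_morphism (sch X) K (str X) \<and>
    separated (sch X) K (str X) \<and> finite_type (sch X) K (str X)"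

definition complete_over :: "'u space \<Rightarrow> 'u scheme_over \<Rightarrow> bool"
  where "complete_over K X \<longleftrightarrow> proper (sch X) K (str X)"

definition mor_over :: "'u space \<Rightarrow> 'u scheme_over \<Rightarrow> 'u scheme_over \<Rightarrow> 'u mor \<Rightarrow> bool"
  where "mor_over K X Y f \<longleftrightarrow> is_morphism (sch X) (sch Y) f \<and>
    comp_mor (sch X) (sch Y) K (str Y) f = str X"

definition proper_mor :: "'u space \<Rightarrow> 'u scheme_over \<Rightarrow> 'u scheme_over \<Rightarrow> 'u mor \<Rightarrow> bool"
  where "proper_mor K X Y f \<longleftrightarrow> mor_over K X Y f \<and> proper (sch X) (sch Y) f"

definition generic_point :: "('a, 'b) ringed_space \<Rightarrow> 'a"
  where "generic_point X = (THE x. x \<in> pt_set X \<and> pts X closure_of {x} = pt_set X)"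

definition function_field :: "('a, 'b) ringed_space \<Rightarrow> ('a set \<times> 'b) set ring"
  where "function_field X = stalk X (generic_point X)"

definition dominant :: "('a, 'b) ringed_space \<Rightarrow> ('c, 'd) ringed_space \<Rightarrow>
    ('a, 'b, 'c, 'd) morphism \<Rightarrow> bool"
  where "dominant X Y f \<longleftrightarrow> pts Y closure_of (pt f ` pt_set X) = pt_set Y"

definition generically_finite :: "('a, 'b) ringed_space \<Rightarrow> ('c, 'd) ringed_space \<Rightarrow>
    ('a, 'b, 'c, 'd) morphism \<Rightarrow> bool"
  where "generically_finite X Y f \<longleftrightarrow> finite {x \<in> pt_set X. pt f x = generic_point Y}"

text \<open>\<open>d = [k(X) : k(Y)]\<close>; a dominant morphism sends the generic point of \<open>X\<close> to that of \<open>Y\<close>.\<close>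

definition has_degree :: "('a, 'b) ringed_space \<Rightarrow> ('c, 'd) ringed_space \<Rightarrow>
    ('a, 'b, 'c, 'd) morphism \<Rightarrow> nat \<Rightarrow> bool"
  where "has_degree X Y f d \<longleftrightarrow> ring.dimension (function_field X) d
    (stalk_map X f (generic_point X) ` carrier (function_field Y)) (carrier (function_field X))"

definition gen_finite_of_degree :: "'u space \<Rightarrow> 'u scheme_over \<Rightarrow> 'u scheme_over \<Rightarrow> 'u mor \<Rightarrow> nat \<Rightarrow> bool"
  where "gen_finite_of_degree K X Y f d \<longleftrightarrow> proper_mor K X Y f \<and> dominant (sch X) (sch Y) f \<and>
    generically_finite (sch X) (sch Y) f \<and> has_degree (sch X) (sch Y) f d"


subsection \<open>Regularity and smoothness\<close>

definition has_prime_chain :: "('a, 'm) ring_scheme \<Rightarrow> nat \<Rightarrow> bool"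
  where "has_prime_chain A n \<longleftrightarrow>
    (\<exists>P. (\<forall>i\<le>n. primeideal (P i) A) \<and> (\<forall>i<n. P i \<subset> P (Suc i)))"

definition krull_dim :: "('a, 'm) ring_scheme \<Rightarrow> nat \<Rightarrow> bool"
  where "krull_dim A n \<longleftrightarrow> has_prime_chain A n \<and> \<not> has_prime_chain A (Suc n)"

definition regular_local_ring :: "('a, 'm) ring_scheme \<Rightarrow> bool"
  where "regular_local_ring A \<longleftrightarrow> local_ring A \<and> noetherian_ring A \<and>
    (\<exists>n. krull_dim A n \<and>
       (\<exists>F \<subseteq> carrier A. finite F \<and> card F = n \<and> Idl\<^bsub>A\<^esub> F = max_ideal A))"

definition regular :: "'u scheme_over \<Rightarrow> bool"
  where "regular X \<longleftrightarrow> (\<forall>x \<in> pt_set (sch X). regular_local_ring (stalk (sch X) x))"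

text \<open>Smoothness of a variety is taken in the sense of EGA IV, 17.3.1: formally smooth and locally
  of finite presentation, where the latter is automatic over a field. Formal smoothness is the
  existence of liftings along closed immersions of affine schemes over \<open>K\<close> defined by an ideal of
  square zero (this is equivalent to nilpotent ideals by induction).\<close>

definition square_zero_immersion :: "'u space \<Rightarrow> 'u space \<Rightarrow> 'u mor \<Rightarrow> bool"
  where "square_zero_immersion T0 T i \<longleftrightarrow> closed_immersion T0 T i \<and>
    (\<forall>a \<in> carrier (sect T (pt_set T)). \<forall>b \<in> carrier (sect T (pt_set T)).
       sh i (pt_set T) a = \<zero>\<^bsub>sect T0 (pt_set T0)\<^esub> \<and> sh i (pt_set T) b = \<zero>\<^bsub>sect T0 (pt_set T0)\<^esub> \<longrightarrow>
       a \<otimes>\<^bsub>sect T (pt_set T)\<^esub> b = \<zero>\<^bsub>sect T (pt_set T)\<^esub>)"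

definition smooth :: "'u space \<Rightarrow> 'u scheme_over \<Rightarrow> bool"
  where "smooth K X \<longleftrightarrow>
    (\<forall>T0 T i g. scheme (sch T0) \<and> affine_scheme (sch T) \<and> is_morphism (sch T) K (str T) \<and>
       mor_over K T0 T i \<and> square_zero_immersion (sch T0) (sch T) i \<and> mor_over K T0 X g \<longrightarrow>
       (\<exists>h. mor_over K T X h \<and> comp_mor (sch T0) (sch T) (sch X) h i = g))"


subsection \<open>Correspondences\<close>

text \<open>All diagrams live in the category of varieties under consideration: its objects are the
  varieties in \<open>V\<close>, its morphisms all proper morphisms over \<open>K\<close> between them. In particular the middle term of
  a correspondence belongs to \<open>V\<close>, as it must for a functor on that category to be evaluated on it.\<close>

definition is_correspondence :: "'u space \<Rightarrow> 'u scheme_over set \<Rightarrow> 'u scheme_over \<Rightarrow>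
    'u scheme_over \<Rightarrow> 'u scheme_over \<Rightarrow> 'u mor \<Rightarrow> 'u mor \<Rightarrow> nat \<Rightarrow> bool"
  \<comment> \<open>\<open>Y \<leftarrow> Z \<rightarrow> X\<close> is a correspondence from \<open>Y\<close> to \<open>X\<close> of multiplicity \<open>d\<close>\<close>
  where "is_correspondence K V Y X Z f g d \<longleftrightarrow>
    Z \<in> V \<and> gen_finite_of_degree K Z Y f d \<and> proper_mor K Z X g"

definition p_equivalent :: "'u space \<Rightarrow> 'u scheme_over set \<Rightarrow> nat \<Rightarrow> 'u scheme_over \<Rightarrow>
    'u scheme_over \<Rightarrow> bool"
  where "p_equivalent K V p X Y \<longleftrightarrow>
    (\<exists>Z f g d. is_correspondence K V Y X Z f g d \<and> coprime d p) \<and>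
    (\<exists>Z f g d. is_correspondence K V X Y Z f g d \<and> coprime d p)"


section \<open>Tensor products of abelian groups\<close>

definition tensor_rel :: "'a monoid \<Rightarrow> 'b monoid \<Rightarrow> ('a \<times> 'b \<Rightarrow>\<^sub>0 int) set"
  where "tensor_rel A B = generate (free_Abelian_group (carrier A \<times> carrier B))
    ({frag_of (a \<otimes>\<^bsub>A\<^esub> a', b) - frag_of (a, b) - frag_of (a', b) | a a' b.
        a \<in> carrier A \<and> a' \<in> carrier A \<and> b \<in> carrier B} \<union>
     {frag_of (a, b \<otimes>\<^bsub>B\<^esub> b') - frag_of (a, b) - frag_of (a, b') | a b b'.
        a \<in> carrier A \<and> b \<in> carrier B \<and> b' \<in> carrier B})"

definition tensor :: "'a monoid \<Rightarrow> 'b monoid \<Rightarrow> ('a \<times> 'b \<Rightarrow>\<^sub>0 int) set monoid"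
  where "tensor A B = free_Abelian_group (carrier A \<times> carrier B) Mod tensor_rel A B"

definition tensor_coset :: "'a monoid \<Rightarrow> 'b monoid \<Rightarrow> ('a \<times> 'b \<Rightarrow>\<^sub>0 int) \<Rightarrow> ('a \<times> 'b \<Rightarrow>\<^sub>0 int) set"
  where "tensor_coset A B c = tensor_rel A B #>\<^bsub>free_Abelian_group (carrier A \<times> carrier B)\<^esub> c"

definition pure_tensor :: "'a monoid \<Rightarrow> 'b monoid \<Rightarrow> 'a \<Rightarrow> 'b \<Rightarrow> ('a \<times> 'b \<Rightarrow>\<^sub>0 int) set"
  where "pure_tensor A B a b = tensor_coset A B (frag_of (a, b))"

text \<open>The homomorphism induced by \<open>f\<close> and \<open>g\<close>, with values in \<open>tensor A B\<close>.\<close>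

definition tensor_map :: "'a monoid \<Rightarrow> 'b monoid \<Rightarrow> ('c \<Rightarrow> 'a) \<Rightarrow> ('d \<Rightarrow> 'b) \<Rightarrow>
    ('c \<times> 'd \<Rightarrow>\<^sub>0 int) set \<Rightarrow> ('a \<times> 'b \<Rightarrow>\<^sub>0 int) set"
  where "tensor_map A B f g C =
    (\<Union>c\<in>C. tensor_coset A B (frag_extend (\<lambda>(a, b). frag_of (f a, g b)) c))"

definition Z_localized :: "nat \<Rightarrow> rat monoid"
  where "Z_localized p = \<lparr>carrier = {of_int a / of_nat b | a b. b > 0 \<and> coprime b p},
    monoid.mult = (+), one = 0\<rparr>"

text \<open>For a subgroup \<open>N\<close> of \<open>G\<close>, the tensor product of \<open>N\<close> with \<open>Z_localized p\<close> as a subgroup of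
  that of \<open>G\<close>, that is, the image of the (injective) map induced by the inclusion.\<close>

definition localized_subgroup :: "nat \<Rightarrow> 'a monoid \<Rightarrow> 'a set \<Rightarrow> ('a \<times> rat \<Rightarrow>\<^sub>0 int) set set"
  where "localized_subgroup p G N =
    tensor_map G (Z_localized p) (\<lambda>n. n) (\<lambda>q. q) ` carrier (tensor (G\<lparr>carrier := N\<rparr>) (Z_localized p))"


section \<open>Pairs of functors\<close>

text \<open>Abelian groups are written as commutative groups \<open>'g monoid\<close>. A morphism of
  schemes does not record its source and target, so these are arguments of \<open>on_mor\<close>.\<close>

record ('u, 'g) functor_data =
  on_obj :: "'u scheme_over \<Rightarrow> 'g monoid"
  on_mor :: "'u scheme_over \<Rightarrow> 'u scheme_over \<Rightarrow> 'u mor \<Rightarrow> 'g \<Rightarrow> 'g"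

definition functor_to_Ab :: "'u space \<Rightarrow> 'u scheme_over set \<Rightarrow> ('u, 'g) functor_data \<Rightarrow> bool"
  where "functor_to_Ab K V F \<longleftrightarrow>
    (\<forall>X \<in> V. comm_group (on_obj F X)) \<and>
    (\<forall>X \<in> V. \<forall>Y \<in> V. \<forall>f. proper_mor K X Y f \<longrightarrow> on_mor F X Y f \<in> hom (on_obj F X) (on_obj F Y)) \<and>
    (\<forall>X \<in> V. \<forall>a \<in> carrier (on_obj F X). on_mor F X X (id_mor (sch X)) a = a) \<and>
    (\<forall>X \<in> V. \<forall>Y \<in> V. \<forall>Z \<in> V. \<forall>f g. proper_mor K X Y f \<and> proper_mor K Y Z g \<longrightarrow>
       (\<forall>a \<in> carrier (on_obj F X).
          on_mor F X Z (comp_mor (sch X) (sch Y) (sch Z) g f) a = on_mor F Y Z g (on_mor F X Y f a)))"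

definition left_module :: "'r ring \<Rightarrow> 'h monoid \<Rightarrow> ('r \<Rightarrow> 'h \<Rightarrow> 'h) \<Rightarrow> bool"
  where "left_module A M act \<longleftrightarrow> ring A \<and> comm_group M \<and>
    (\<forall>r \<in> carrier A. \<forall>x \<in> carrier M. act r x \<in> carrier M) \<and>
    (\<forall>r \<in> carrier A. \<forall>x \<in> carrier M. \<forall>y \<in> carrier M. act r (x \<otimes>\<^bsub>M\<^esub> y) = act r x \<otimes>\<^bsub>M\<^esub> act r y) \<and>
    (\<forall>r \<in> carrier A. \<forall>s \<in> carrier A. \<forall>x \<in> carrier M. act (r \<oplus>\<^bsub>A\<^esub> s) x = act r x \<otimes>\<^bsub>M\<^esub> act s x) \<and>
    (\<forall>r \<in> carrier A. \<forall>s \<in> carrier A. \<forall>x \<in> carrier M. act (r \<otimes>\<^bsub>A\<^esub> s) x = act r (act s x)) \<and>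
    (\<forall>x \<in> carrier M. act \<one>\<^bsub>A\<^esub> x = x)"

definition nilpotent :: "'r ring \<Rightarrow> 'r \<Rightarrow> bool"
  where "nilpotent A r \<longleftrightarrow> (\<exists>n::nat. r [^]\<^bsub>A\<^esub> n = \<zero>\<^bsub>A\<^esub>)"

text \<open>\<open>A S\<close> is the ring structure on the group \<open>R(S)\<close>, \<open>act S\<close> the module structure on \<open>H(S)\<close>, and
  \<open>prd X S f\<close> the homomorphism from the tensor product of \<open>R(X)\<close> and \<open>H(S)\<close> to \<open>H(X)\<close>.\<close>

definition cond_R1 where
  "cond_R1 Reg R A \<longleftrightarrow> (\<forall>S \<in> Reg. ring (A S) \<and> add_monoid (A S) = on_obj R S)"

definition cond_R2 where
  "cond_R2 K V Reg R A \<longleftrightarrow> (\<forall>X \<in> V. \<forall>S \<in> Reg. \<forall>f d. gen_finite_of_degree K X S f d \<longrightarrow>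
     (\<exists>u \<in> carrier (on_obj R X). nilpotent (A S) (on_mor R X S f u \<ominus>\<^bsub>A S\<^esub> [d] \<cdot>\<^bsub>A S\<^esub> \<one>\<^bsub>A S\<^esub>)))"

definition cond_H1 where
  "cond_H1 K V Reg R H prd \<longleftrightarrow> (\<forall>X \<in> V. \<forall>S \<in> Reg. \<forall>f d. gen_finite_of_degree K X S f d \<longrightarrow>
     prd X S f \<in> hom (tensor (on_obj R X) (on_obj H S)) (on_obj H X))"

definition cond_H2 where
  "cond_H2 K V Reg R H A prd act \<longleftrightarrow>
     (\<forall>S \<in> Reg. left_module (A S) (on_obj H S) (act S)) \<and>
     (\<forall>X \<in> V. \<forall>S \<in> Reg. \<forall>f d. gen_finite_of_degree K X S f d \<longrightarrow>
        (\<forall>x \<in> carrier (on_obj R X). \<forall>s \<in> carrier (on_obj H S).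
           on_mor H X S f (prd X S f (pure_tensor (on_obj R X) (on_obj H S) x s))
             = act S (on_mor R X S f x) s))"

definition satisfies_R_H :: "'u space \<Rightarrow> 'u scheme_over set \<Rightarrow> 'u scheme_over set \<Rightarrow>
    ('u, 'r) functor_data \<Rightarrow> ('u, 'h) functor_data \<Rightarrow> bool"
  where "satisfies_R_H K V Reg R H \<longleftrightarrow> (\<exists>A prd act.
    cond_R1 Reg R A \<and> cond_R2 K V Reg R A \<and> cond_H1 K V Reg R H prd \<and> cond_H2 K V Reg R H A prd act)"

definition H_sub :: "'u space \<Rightarrow> ('u, 'h) functor_data \<Rightarrow> 'u scheme_over \<Rightarrow> 'h set"
  where "H_sub K H X = on_mor H X (base K) (str X) ` carrier (on_obj H X)"

end

theory Submission
  imports Defs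
begin

text \<open>A correspondence \<open>Y \<leftarrow> Z \<rightarrow> X\<close> of multiplicity \<open>d\<close> gives \<open>u \<in> R(Z)\<close> whose push-forward
  \<open>r \<in> R(Y)\<close> differs from \<open>d\<close> by a nilpotent element. So \<open>d\<close> is invertible modulo \<open>r\<close> up to a power:
  for every \<open>h \<in> H(Y)\<close>, some \<open>d ^ n \<cdot> h\<close> has the form \<open>r \<cdot> h'\<close>, which by the projection formula
  is the push-forward of \<open>u \<cdot> h' \<in> H(Z)\<close>. Pushing forward to the base through \<open>X\<close>
  instead of \<open>Y\<close> shows that \<open>H\<^sub>X\<close> contains \<open>d ^ n\<close> times any element of \<open>H\<^sub>Y\<close>; after localisation
  at \<open>p\<close>, where \<open>d\<close> is a unit, \<open>H\<^sub>Y\<close> is contained in \<open>H\<^sub>X\<close>.\<close>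

section \<open>Localised subgroups\<close>

text \<open>Products stay in the carriers of \<open>A\<close> and \<open>B\<close>, so every relator
  is supported on the generators; hence \<open>generate\<close> yields a subgroup.\<close>

lemma tensor_relators_closed:
  assumes "group A" "group B"
  shows "{frag_of (a \<otimes>\<^bsub>A\<^esub> a', b) - frag_of (a, b) - frag_of (a', b) | a a' b.
        a \<in> carrier A \<and> a' \<in> carrier A \<and> b \<in> carrier B} \<union>
     {frag_of (a, b \<otimes>\<^bsub>B\<^esub> b') - frag_of (a, b) - frag_of (a, b') | a b b'.
        a \<in> carrier A \<and> b \<in> carrier B \<and> b' \<in> carrier B}
    \<subseteq> carrier (free_Abelian_group (carrier A \<times> carrier B))"
proof -
  interpret A: group A by fact
  interpret B: group B by fact
  have diff: "Poly_Mapping.keys (x - y) \<subseteq> U"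
    if "Poly_Mapping.keys x \<subseteq> U" "Poly_Mapping.keys y \<subseteq> U" for x y :: "'a \<times> 'c \<Rightarrow>\<^sub>0 int" and U
    using keys_diff[of x y] that by blast
  show ?thesis
    by (intro subsetI, elim UnE CollectE exE conjE)
      (simp_all only: carrier_free_Abelian_group_iff, (intro diff; simp)+)
qed

lemma subgroup_tensor_rel:
  assumes "group A" "group B"
  shows "subgroup (tensor_rel A B) (free_Abelian_group (carrier A \<times> carrier B))"
  unfolding tensor_rel_def
  by (intro group.generate_is_subgroup tensor_relators_closed assms) simp

lemma tensor_rel_add:
  assumes "group A" "group B" "x \<in> tensor_rel A B" "y \<in> tensor_rel A B"
  shows "x + y \<in> tensor_rel A B"
  using subgroup.m_closed[OF subgroup_tensor_rel[OF assms(1,2)] assms(3,4)] by simp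

lemma tensor_rel_uminus:
  assumes "group A" "group B" "x \<in> tensor_rel A B"
  shows "- x \<in> tensor_rel A B"
proof -
  \<comment> \<open>The inverse in \<open>free_Abelian_group\<close> is rewritten to
    \<open>- x\<close> only for \<open>x\<close> supported on the generators.\<close>
  have "Poly_Mapping.keys x \<subseteq> carrier A \<times> carrier B"
    using subgroup.mem_carrier[OF subgroup_tensor_rel[OF assms(1,2)] assms(3)] by simp
  then show ?thesis
    using subgroup.m_inv_closed[OF subgroup_tensor_rel[OF assms(1,2)] assms(3)] by simp
qed

lemma tensor_rel_zero: "0 \<in> tensor_rel A B"
  using generate.one[of "free_Abelian_group (carrier A \<times> carrier B)"]
  by (simp add: tensor_rel_def)

lemma tensor_rel_diff:
  assumes "group A" "group B" "x \<in> tensor_rel A B" "y \<in> tensor_rel A B"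
  shows "x - y \<in> tensor_rel A B"
  using tensor_rel_add[OF assms(1-3) tensor_rel_uminus[OF assms(1,2,4)]] by simp

lemma tensor_rel_left:
  assumes "a \<in> carrier A" "a' \<in> carrier A" "b \<in> carrier B"
  shows "frag_of (a \<otimes>\<^bsub>A\<^esub> a', b) - frag_of (a, b) - frag_of (a', b) \<in> tensor_rel A B"
  unfolding tensor_rel_def by (rule generate.incl) (use assms in blast)

lemma tensor_rel_right:
  assumes "a \<in> carrier A" "b \<in> carrier B" "b' \<in> carrier B"
  shows "frag_of (a, b \<otimes>\<^bsub>B\<^esub> b') - frag_of (a, b) - frag_of (a, b') \<in> tensor_rel A B"
  unfolding tensor_rel_def by (rule generate.incl) (use assms in blast)

text \<open>A bilinearity relator over \<open>N\<close> is also one over \<open>G\<close>, since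
  \<open>N\<close> carries the restricted operation. Hence the inclusion induces a well-defined map
  of tensor products.\<close>

lemma tensor_rel_subgroup_mono:
  assumes G: "group G" and B: "group B" and N: "subgroup N G"
  shows "tensor_rel (G\<lparr>carrier := N\<rparr>) B \<subseteq> tensor_rel G B"
proof
  let ?N = "G\<lparr>carrier := N\<rparr>"
  have N_group: "group ?N"
    by (rule subgroup.subgroup_is_group[OF N G])
  have NG: "N \<subseteq> carrier G"
    using N by (rule subgroup.subset)
  fix x assume "x \<in> tensor_rel ?N B"
  then show "x \<in> tensor_rel G B"
    unfolding tensor_rel_def[of ?N]
  proof induction
    case one
    then show ?case by (simp add: tensor_rel_zero)
  next
    case (incl h)
    then show ?case
      using NG by (auto intro!: tensor_rel_left tensor_rel_right)
  next
    case (inv h)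
    then have "h \<in> carrier (free_Abelian_group (carrier ?N \<times> carrier B))"
      using tensor_relators_closed[OF N_group B] by blast
    moreover have "h \<in> tensor_rel G B"
      using inv NG by (auto intro!: tensor_rel_left tensor_rel_right)
    ultimately show ?case
      using tensor_rel_uminus[OF G B] by simp
  next
    case (eng h1 h2)
    then show ?case
      using tensor_rel_add[OF G B] by simp
  qed
qed

section \<open>Cosets modulo the relations\<close>

lemma tensor_coset_eq: "tensor_coset A B c = (\<lambda>x. x + c) ` tensor_rel A B"
  by (auto simp: tensor_coset_def r_coset_def)

lemma tensor_coset_eqI:
  assumes "group A" "group B" "c - c' \<in> tensor_rel A B"
  shows "tensor_coset A B c = tensor_coset A B c'"
proof -
  have "\<exists>y\<in>tensor_rel A B. x + c = y + c'" if "x \<in> tensor_rel A B" for x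
    using tensor_rel_add[OF assms(1,2) that assms(3)]
    by (intro bexI[of _ "x + (c - c')"]) auto
  moreover have "\<exists>y\<in>tensor_rel A B. x + c' = y + c" if "x \<in> tensor_rel A B" for x
    using tensor_rel_diff[OF assms(1,2) that assms(3)]
    by (intro bexI[of _ "x - (c - c')"]) auto
  ultimately show ?thesis
    unfolding tensor_coset_eq by blast
qed

lemma carrier_tensor:
  "carrier (tensor A B) = tensor_coset A B ` carrier (free_Abelian_group (carrier A \<times> carrier B))"
  by (auto simp: tensor_def FactGroup_def RCOSETS_def tensor_coset_def)

lemma pure_tensor_closed:
  assumes "a \<in> carrier A" "b \<in> carrier B"
  shows "pure_tensor A B a b \<in> carrier (tensor A B)"
  using assms unfolding pure_tensor_def carrier_tensor by (intro imageI) auto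

section \<open>The group Z_(p) and tensor products with it\<close>

lemma Z_localized_group: "group (Z_localized p)"
proof (rule groupI)
  let ?Z = "Z_localized p"
  fix x assume "x \<in> carrier ?Z"
  then obtain a b where x: "x = of_int a / of_nat b" "b > 0" "coprime b p"
    by (auto simp: Z_localized_def)
  then have "- x \<in> carrier ?Z"
    by (auto simp: Z_localized_def intro!: exI[of _ "- a"] exI[of _ b])
  then show "\<exists>y\<in>carrier ?Z. y \<otimes>\<^bsub>?Z\<^esub> x = \<one>\<^bsub>?Z\<^esub>"
    by (intro bexI[of _ "- x"]) (auto simp: Z_localized_def)
  fix y assume "y \<in> carrier ?Z"
  then obtain c d where y: "y = of_int c / of_nat d" "d > 0" "coprime d p"
    by (auto simp: Z_localized_def)
  have "x + y = of_int (a * int d + c * int b) / of_nat (b * d)"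
    using x y by (auto simp: field_simps)
  moreover have "b * d > 0" "coprime (b * d) p"
    using x y by auto
  ultimately have "x + y \<in> carrier ?Z"
    unfolding Z_localized_def partial_object.select_convs by blast
  then show "x \<otimes>\<^bsub>?Z\<^esub> y \<in> carrier ?Z"
    by (simp add: Z_localized_def)
next
  show "\<one>\<^bsub>Z_localized p\<^esub> \<in> carrier (Z_localized p)"
    unfolding Z_localized_def partial_object.select_convs monoid.select_convs
    by (rule CollectI, rule exI[of _ 0], rule exI[of _ 1]) simp
qed (auto simp: Z_localized_def)

text \<open>Integers prime to \<open>p\<close> act invertibly on Z_(p), as they can be absorbed into
  the denominator. This is where localisation enters.\<close>

lemma Z_localized_divide:
  assumes "q \<in> carrier (Z_localized p)" "m > 0" "coprime m p"
  shows "q / of_nat m \<in> carrier (Z_localized p)"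
proof -
  obtain a b where "q = of_int a / of_nat b" "b > 0" "coprime b p"
    using assms by (auto simp: Z_localized_def)
  then have "q / of_nat m = of_int a / of_nat (b * m)" "b * m > 0" "coprime (b * m) p"
    using assms by auto
  then show ?thesis
    unfolding Z_localized_def partial_object.select_convs by blast
qed

text \<open>The map induced by the inclusion sends the class of \<open>c\<close> to the class of the
  same \<open>c\<close> modulo the larger group of relations.\<close>

lemma localized_subgroup_eq:
  assumes G: "group G" and N: "subgroup N G"
  shows "localized_subgroup p G N = tensor_coset G (Z_localized p) `
    carrier (free_Abelian_group (N \<times> carrier (Z_localized p)))"
proof -
  let ?N = "G\<lparr>carrier := N\<rparr>" and ?Z = "Z_localized p"
  have frag: "frag_extend (\<lambda>(a, b). frag_of (a, b)) c = c" for c :: "'a \<times> rat \<Rightarrow>\<^sub>0 int"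
  proof -
    have "(\<lambda>(a, b). frag_of (a, b)) = (frag_of :: 'a \<times> rat \<Rightarrow> _)" by auto
    then show ?thesis by (simp only: frag_expansion[symmetric])
  qed
  have "tensor_map G ?Z (\<lambda>n. n) (\<lambda>q. q) (tensor_coset ?N ?Z c) = tensor_coset G ?Z c" for c
  proof -
    have "tensor_coset G ?Z (x + c) = tensor_coset G ?Z c" if "x \<in> tensor_rel ?N ?Z" for x
      using that tensor_rel_subgroup_mono[OF G Z_localized_group N]
      by (intro tensor_coset_eqI[OF G Z_localized_group]) auto
    \<comment> \<open>\<open>tensor_map\<close> is a union over representatives; it collapses to
      their common coset only if a representative exists.\<close>
    moreover have "tensor_rel ?N ?Z \<noteq> {}"
      using tensor_rel_zero by blast
    ultimately show ?thesis
      unfolding tensor_map_def tensor_coset_eq[of ?N]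
      by (simp add: frag)
  qed
  then show ?thesis
    unfolding localized_subgroup_def carrier_tensor image_image by simp
qed

text \<open>Additively, \<open>h\<close> tensor \<open>m q\<close> equals \<open>m h\<close> tensor
  \<open>q\<close>: both sides are additive in \<open>m\<close>, one by additivity on the right, the
  other by additivity on the left.\<close>

lemma tensor_rel_pow:
  assumes G: "group G" and h: "h \<in> carrier G" and q: "q \<in> carrier (Z_localized p)"
  shows "frag_of (h, of_nat m * q) - frag_of (h [^]\<^bsub>G\<^esub> m, q) \<in> tensor_rel G (Z_localized p)"
proof -
  interpret G: group G by fact
  let ?Z = "Z_localized p"
  interpret Z: group ?Z by (rule Z_localized_group)
  note add = tensor_rel_add[OF G Z_localized_group] and diff = tensor_rel_diff[OF G Z_localized_group]
  have mult: "x \<otimes>\<^bsub>?Z\<^esub> y = x + y" and one: "\<one>\<^bsub>?Z\<^esub> = 0" for x y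
    by (simp_all add: Z_localized_def)
  have mq: "of_nat m * q \<in> carrier ?Z" for m
  proof (induction m)
    case 0
    then show ?case using Z.one_closed by (simp add: one)
  next
    case (Suc m)
    then show ?case using Z.m_closed[OF q Suc] by (simp add: mult algebra_simps)
  qed
  show ?thesis
  proof (induction m)
    case 0
    \<comment> \<open>The relator for 0 + 0 = 0 is the negative of a generator. The same is used
      below for the neutral element of \<open>G\<close>.\<close>
    have "frag_of (h, 0) \<in> tensor_rel G ?Z"
      using tensor_rel_uminus[OF G Z_localized_group tensor_rel_right[OF h Z.one_closed Z.one_closed]]
      by (simp add: mult one)
    moreover have "frag_of (\<one>\<^bsub>G\<^esub>, q) \<in> tensor_rel G ?Z"
      using tensor_rel_uminus[OF G Z_localized_group tensor_rel_left[OF G.one_closed G.one_closed q]]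
      by simp
    ultimately show ?case
      using diff by simp
  next
    case (Suc m)
    have 1: "frag_of (h, of_nat m * q + q) - frag_of (h, of_nat m * q) - frag_of (h, q) \<in> tensor_rel G ?Z"
      using tensor_rel_right[OF h mq[of m] q] by (simp add: mult)
    have 2: "frag_of (h [^]\<^bsub>G\<^esub> m \<otimes>\<^bsub>G\<^esub> h, q) - frag_of (h [^]\<^bsub>G\<^esub> m, q) - frag_of (h, q)
        \<in> tensor_rel G ?Z"
      using h q by (intro tensor_rel_left) auto
    from diff[OF add[OF 1 Suc.IH] 2] show ?case
      by (simp add: algebra_simps)
  qed
qed

text \<open>A generator \<open>(h, q)\<close> is equivalent to \<open>(h ^ m, q / m)\<close>, since
  \<open>m\<close> can be moved across the tensor sign. The exponent may vary with \<open>h\<close>,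
  because each generator is replaced separately.\<close>

lemma localized_subgroup_mono:
  assumes G: "group G" and N: "subgroup N G" and M: "subgroup M G"
    and pow: "\<And>h. h \<in> N \<Longrightarrow> \<exists>m. m > 0 \<and> coprime m p \<and> h [^]\<^bsub>G\<^esub> (m::nat) \<in> M"
  shows "localized_subgroup p G N \<subseteq> localized_subgroup p G M"
proof -
  let ?Z = "Z_localized p"
  \<comment> \<open>The claim concerns representatives rather than cosets, so that induction over
    formal combinations applies.\<close>
  have "\<exists>c'. Poly_Mapping.keys c' \<subseteq> M \<times> carrier ?Z \<and> c - c' \<in> tensor_rel G ?Z"
    if "Poly_Mapping.keys c \<subseteq> N \<times> carrier ?Z" for c :: "'a \<times> rat \<Rightarrow>\<^sub>0 int"
    using that
  proof (induction c rule: frag_induction)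
    case zero
    then show ?case using tensor_rel_zero by (intro exI[of _ 0]) auto
  next
    case (one x)
    then obtain h q where x: "x = (h, q)" "h \<in> N" "q \<in> carrier ?Z" by auto
    then obtain m where m: "m > 0" "coprime m p" "h [^]\<^bsub>G\<^esub> m \<in> M" using pow by blast
    have "q / of_nat m \<in> carrier ?Z"
      using x m by (intro Z_localized_divide) auto
    then show ?case
      using x m tensor_rel_pow[OF G subgroup.mem_carrier[OF N \<open>h \<in> N\<close>], of "q / of_nat m" p m]
      by (intro exI[of _ "frag_of (h [^]\<^bsub>G\<^esub> m, q / of_nat m)"]) auto
  next
    case (diff a b)
    then obtain a' b' where
      a': "Poly_Mapping.keys a' \<subseteq> M \<times> carrier ?Z" "a - a' \<in> tensor_rel G ?Z" and
      b': "Poly_Mapping.keys b' \<subseteq> M \<times> carrier ?Z" "b - b' \<in> tensor_rel G ?Z"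
      by blast
    have "(a - b) - (a' - b') \<in> tensor_rel G ?Z"
      using tensor_rel_diff[OF G Z_localized_group a'(2) b'(2)] by (simp add: algebra_simps)
    moreover have "Poly_Mapping.keys (a' - b') \<subseteq> M \<times> carrier ?Z"
      using keys_diff[of a' b'] a'(1) b'(1) by blast
    ultimately show ?case by blast
  qed
  note approx = this
  show ?thesis
    unfolding localized_subgroup_eq[OF G N] localized_subgroup_eq[OF G M]
  proof (rule image_subsetI)
    fix c assume "c \<in> carrier (free_Abelian_group (N \<times> carrier ?Z))"
    then obtain c' where c': "Poly_Mapping.keys c' \<subseteq> M \<times> carrier ?Z" "c - c' \<in> tensor_rel G ?Z"
      using approx[of c] by auto
    then show "tensor_coset G ?Z c \<in> tensor_coset G ?Z ` carrier (free_Abelian_group (M \<times> carrier ?Z))"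
      using tensor_coset_eqI[OF G Z_localized_group c'(2)] by simp
  qed
qed

section \<open>Elements that are integers up to nilpotents\<close>

text \<open>Modules are written multiplicatively, so the multiple \<open>d h\<close> appears as a
  power; on both sides, raising \<open>d\<close> by 1 multiplies by \<open>h\<close>.\<close>

lemma left_module_add_pow_one:
  fixes d :: nat
  assumes M: "left_module A M act" and h: "h \<in> carrier M"
  shows "act ([d] \<cdot>\<^bsub>A\<^esub> \<one>\<^bsub>A\<^esub>) h = h [^]\<^bsub>M\<^esub> d"
proof -
  interpret A: ring A using M by (simp add: left_module_def)
  interpret M: comm_group M using M by (simp add: left_module_def)
  have act_closed: "act r h \<in> carrier M" if "r \<in> carrier A" for r
    using M h that by (simp add: left_module_def)
  have act_add: "act (r \<oplus>\<^bsub>A\<^esub> s) h = act r h \<otimes>\<^bsub>M\<^esub> act s h" if "r \<in> carrier A" "s \<in> carrier A" for r s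
    using M h that by (simp add: left_module_def)
  show ?thesis
  proof (induction d)
    case 0
    \<comment> \<open>An idempotent of a group is neutral.\<close>
    have "act \<zero>\<^bsub>A\<^esub> h \<otimes>\<^bsub>M\<^esub> act \<zero>\<^bsub>A\<^esub> h = act \<zero>\<^bsub>A\<^esub> h"
      using act_add[OF A.zero_closed A.zero_closed] by simp
    then have "act \<zero>\<^bsub>A\<^esub> h = \<one>\<^bsub>M\<^esub>"
      using M.r_cancel_one[OF act_closed act_closed] by simp
    then show ?case by simp
  next
    case (Suc d)
    moreover have "act \<one>\<^bsub>A\<^esub> h = h" using M h by (simp add: left_module_def)
    ultimately show ?case
      using act_add[of "[d] \<cdot>\<^bsub>A\<^esub> \<one>\<^bsub>A\<^esub>" "\<one>\<^bsub>A\<^esub>"] by simp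
  qed
qed

text \<open>Write r = \<nu> + d. Additively, if d^n \<nu> h = r h', then multiplying r h = \<nu> h +
  d h by d^n gives d^(n+1) h = r (d^n h - h'). Vanishing of \<nu>^n is assumed on the single element
  \<open>h\<close>, which lets the induction pass from \<open>h\<close> to \<nu> h.\<close>

lemma left_module_pow_in_range:
  fixes d n :: nat
  assumes M: "left_module A M act" and r: "r \<in> carrier A"
    and nilp: "act ((r \<ominus>\<^bsub>A\<^esub> [d] \<cdot>\<^bsub>A\<^esub> \<one>\<^bsub>A\<^esub>) [^]\<^bsub>A\<^esub> n) h = \<one>\<^bsub>M\<^esub>"
    and h: "h \<in> carrier M"
  shows "\<exists>h'\<in>carrier M. h [^]\<^bsub>M\<^esub> (d ^ n) = act r h'"
  using nilp h
proof (induction n arbitrary: h)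
  interpret A: ring A using M by (simp add: left_module_def)
  interpret M: comm_group M using M by (simp add: left_module_def)
  interpret act_r: group_hom M M "act r"
    using M r by unfold_locales (auto simp: left_module_def hom_def)
  define \<nu> where "\<nu> = r \<ominus>\<^bsub>A\<^esub> [d] \<cdot>\<^bsub>A\<^esub> \<one>\<^bsub>A\<^esub>"
  have \<nu>: "\<nu> \<in> carrier A" and r_eq: "r = \<nu> \<oplus>\<^bsub>A\<^esub> [d] \<cdot>\<^bsub>A\<^esub> \<one>\<^bsub>A\<^esub>"
    using r by (auto simp: \<nu>_def A.minus_eq A.a_assoc A.l_neg)
  {
    case 0
    then have "h = \<one>\<^bsub>M\<^esub>" using M by (simp add: left_module_def)
    then show ?case using act_r.hom_one by force
  next
    case (Suc n)
    have \<nu>h: "act \<nu> h \<in> carrier M" using M \<nu> Suc.prems by (simp add: left_module_def)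
    \<comment> \<open>Powers grow on the right, so \<nu>^(n+1) h = \<nu>^n (\<nu> h).\<close>
    have "act (\<nu> [^]\<^bsub>A\<^esub> n) (act \<nu> h) = \<one>\<^bsub>M\<^esub>"
      using Suc.prems M \<nu> by (simp add: left_module_def \<nu>_def[symmetric])
    then obtain h' where h': "h' \<in> carrier M" "act \<nu> h [^]\<^bsub>M\<^esub> (d ^ n) = act r h'"
      using Suc.IH[OF _ \<nu>h] by (auto simp: \<nu>_def)
    have "act r h = act \<nu> h \<otimes>\<^bsub>M\<^esub> h [^]\<^bsub>M\<^esub> d"
      using M \<nu> Suc.prems(2) left_module_add_pow_one[OF M Suc.prems(2), of d]
      by (subst r_eq) (simp add: left_module_def)
    then have "act r (h [^]\<^bsub>M\<^esub> (d ^ n)) = (act \<nu> h \<otimes>\<^bsub>M\<^esub> h [^]\<^bsub>M\<^esub> d) [^]\<^bsub>M\<^esub> (d ^ n)"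
      using Suc.prems(2) by (simp add: act_r.hom_nat_pow)
    also have "\<dots> = act r h' \<otimes>\<^bsub>M\<^esub> h [^]\<^bsub>M\<^esub> (d ^ Suc n)"
      using \<nu>h Suc.prems(2) h' by (simp add: M.pow_mult_distrib M.m_comm M.nat_pow_pow)
    finally have "h [^]\<^bsub>M\<^esub> (d ^ Suc n) = inv\<^bsub>M\<^esub> act r h' \<otimes>\<^bsub>M\<^esub> act r (h [^]\<^bsub>M\<^esub> (d ^ n))"
      using Suc.prems(2) h' by (simp add: M.m_assoc[symmetric] act_r.hom_closed)
    also have "\<dots> = act r (inv\<^bsub>M\<^esub> h' \<otimes>\<^bsub>M\<^esub> h [^]\<^bsub>M\<^esub> (d ^ n))"
      using Suc.prems(2) h' by simp
    finally show ?case using Suc.prems(2) h' by blast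
  }
qed

section \<open>Push-forward to the base\<close>

lemma preim_id_mor:
  assumes "opn X U"
  shows "preim X (id_mor X) U = U"
  using openin_subset[OF assms] by (auto simp: preim_def id_mor_def)

text \<open>Equality must also hold outside the domains: there both sides are
  \<open>undefined\<close>, as \<open>is_morphism\<close> normalises \<open>f\<close>. Inside,
  \<open>id_mor\<close> changes neither points, sections nor preimages of open sets.\<close>

lemma comp_id_mor:
  assumes "is_morphism X S f"
  shows "comp_mor X S S (id_mor S) f = f"
proof (rule morphism.equality)
  have "pt f x \<in> pt_set S" if "x \<in> pt_set X" for x
    using assms that by (auto simp: is_morphism_def continuous_map_def)
  moreover have "pt f \<in> extensional (pt_set X)"
    using assms by (simp add: is_morphism_def)
  ultimately show "pt (comp_mor X S S (id_mor S) f) = pt f"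
    by (auto simp: comp_mor_def id_mor_def fun_eq_iff extensional_def)
  have "sh f U \<in> extensional (carrier (sect S U))" if "opn S U" for U
    using assms that by (auto simp: is_morphism_def dest: spec[of _ U])
  moreover have "sh f U = (\<lambda>_. undefined)" if "\<not> opn S U" for U
    using assms that by (auto simp: is_morphism_def dest: spec[of _ U])
  ultimately show "sh (comp_mor X S S (id_mor S) f) = sh f"
    by (auto simp: comp_mor_def preim_id_mor fun_eq_iff extensional_def)
      (auto simp: id_mor_def)
qed simp

text \<open>The structural morphism of \<open>base K\<close> is the identity, so compatibility over
  \<open>K\<close> is the left identity law.\<close>

lemma proper_mor_structural:
  assumes "complete_over K X"
  shows "proper_mor K X (base K) (str X)"
  using assms by (simp add: proper_mor_def mor_over_def complete_over_def proper_def comp_id_mor)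

text \<open>Functoriality applies to \<open>str X\<close> after \<open>f\<close>, which is
  \<open>str Z\<close>.\<close>

lemma on_mor_str:
  assumes "functor_to_Ab K V F" "base K \<in> V" "Z \<in> V" "X \<in> V" "complete_over K X"
    and "proper_mor K Z X f" "a \<in> carrier (on_obj F Z)"
  shows "on_mor F X (base K) (str X) (on_mor F Z X f a) = on_mor F Z (base K) (str Z) a"
proof -
  have "comp_mor (sch Z) (sch X) K (str X) f = str Z"
    using assms(6) by (simp add: proper_mor_def mor_over_def)
  moreover have "on_mor F Z (base K) (comp_mor (sch Z) (sch X) (sch (base K)) (str X) f) a
      = on_mor F X (base K) (str X) (on_mor F Z X f a)"
  proof -
    have "\<forall>X \<in> V. \<forall>Y \<in> V. \<forall>Z \<in> V. \<forall>f g. proper_mor K X Y f \<and> proper_mor K Y Z g \<longrightarrow>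
       (\<forall>a \<in> carrier (on_obj F X).
          on_mor F X Z (comp_mor (sch X) (sch Y) (sch Z) g f) a = on_mor F Y Z g (on_mor F X Y f a))"
      using assms(1) unfolding functor_to_Ab_def by (elim conjE)
    from this[rule_format, OF assms(3,4,2) conjI[OF assms(6) proper_mor_structural[OF assms(5)]] assms(7)]
    show ?thesis .
  qed
  ultimately show ?thesis by simp
qed

lemma group_hom_on_mor:
  assumes "functor_to_Ab K V F" "X \<in> V" "Y \<in> V" "proper_mor K X Y f"
  shows "group_hom (on_obj F X) (on_obj F Y) (on_mor F X Y f)"
  using assms unfolding functor_to_Ab_def
  by (intro group_hom.intro group_hom_axioms.intro) (auto simp: comm_group_def)

lemma subgroup_H_sub:
  assumes "functor_to_Ab K V H" "base K \<in> V" "X \<in> V" "complete_over K X"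
  shows "subgroup (H_sub K H X) (on_obj H (base K))"
  unfolding H_sub_def
  by (intro group_hom.img_is_subgroup group_hom_on_mor[OF assms(1)] proper_mor_structural assms)

section \<open>Transfer along a correspondence\<close>

text \<open>Nilpotency of f_* u - d makes some d^n h equal to r h' with r = f_* u; the projection
  formula (H2) reads r h' as the push-forward of the product of \<open>u\<close> and h'.\<close>

lemma pow_in_range_of_push_forward:
  assumes RH: "satisfies_R_H K V Reg R H" and "functor_to_Ab K V R" and H: "functor_to_Ab K V H"
    and "Reg \<subseteq> V" and Z: "Z \<in> V" and S: "S \<in> Reg"
    and f: "gen_finite_of_degree K Z S f d" and h: "h \<in> carrier (on_obj H S)"
  shows "\<exists>n. \<exists>z\<in>carrier (on_obj H Z). h [^]\<^bsub>on_obj H S\<^esub> (d ^ n) = on_mor H Z S f z"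
proof -
  obtain A prd act where R1: "cond_R1 Reg R A" and R2: "cond_R2 K V Reg R A"
    and H1: "cond_H1 K V Reg R H prd" and H2: "cond_H2 K V Reg R H A prd act"
    using RH unfolding satisfies_R_H_def by blast
  have M: "left_module (A S) (on_obj H S) (act S)"
    using H2 S by (simp add: cond_H2_def)
  interpret A: ring "A S" using M by (simp add: left_module_def)
  interpret M: comm_group "on_obj H S" using M by (simp add: left_module_def)
  obtain u where u: "u \<in> carrier (on_obj R Z)"
    and nilp: "nilpotent (A S) (on_mor R Z S f u \<ominus>\<^bsub>A S\<^esub> [d] \<cdot>\<^bsub>A S\<^esub> \<one>\<^bsub>A S\<^esub>)"
    using R2 Z S f unfolding cond_R2_def by blast
  let ?r = "on_mor R Z S f u"
  have "?r \<in> carrier (on_obj R S)"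
    using assms u group_hom.hom_closed[OF group_hom_on_mor, of K V R Z S f u]
    by (auto simp: gen_finite_of_degree_def)
  \<comment> \<open>(R1) makes R(S) the additive group of the ring \<open>A S\<close>.\<close>
  moreover have "carrier (on_obj R S) = carrier (A S)"
    using R1 S by (metis cond_R1_def partial_object.select_convs(1))
  ultimately have r: "?r \<in> carrier (A S)" by simp
  obtain n :: nat where n: "(?r \<ominus>\<^bsub>A S\<^esub> [d] \<cdot>\<^bsub>A S\<^esub> \<one>\<^bsub>A S\<^esub>) [^]\<^bsub>A S\<^esub> n = \<zero>\<^bsub>A S\<^esub>"
    using nilp unfolding nilpotent_def by blast
  \<comment> \<open>Zero is the multiple 0 of the unit and acts as the zeroth power; this turns
    nilpotency into vanishing on \<open>h\<close>.\<close>
  have "act S \<zero>\<^bsub>A S\<^esub> h = \<one>\<^bsub>on_obj H S\<^esub>"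
    using left_module_add_pow_one[OF M h, of 0] by simp
  then obtain h' where h': "h' \<in> carrier (on_obj H S)" "h [^]\<^bsub>on_obj H S\<^esub> (d ^ n) = act S ?r h'"
    using left_module_pow_in_range[OF M r _ h, of d n] n by auto
  let ?z = "prd Z S f (pure_tensor (on_obj R Z) (on_obj H S) u h')"
  have "prd Z S f \<in> hom (tensor (on_obj R Z) (on_obj H S)) (on_obj H Z)"
    using H1 Z S f unfolding cond_H1_def by blast
  then have "?z \<in> carrier (on_obj H Z)"
    using pure_tensor_closed[OF u h'(1)] by (rule hom_in_carrier)
  moreover have "on_mor H Z S f ?z = act S ?r h'"
    using H2 Z S f u h' unfolding cond_H2_def by blast
  ultimately show ?thesis using h' by metis
qed

text \<open>Both legs of the correspondence induce the same map from H(Z) to H(k), so a lift of d^n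
  h to H(Z) places the d^n-fold multiple of the image of \<open>h\<close> in H_X.\<close>

lemma localized_H_sub_mono:
  assumes RH: "satisfies_R_H K V Reg R H" and R: "functor_to_Ab K V R" and H: "functor_to_Ab K V H"
    and Reg: "Reg \<subseteq> V" and K: "base K \<in> V" and Y: "Y \<in> Reg" and X: "X \<in> V"
    and cY: "complete_over K Y" and cX: "complete_over K X"
    and corr: "is_correspondence K V Y X Z f g d" and d: "coprime d p" and p: "prime p"
  shows "localized_subgroup p (on_obj H (base K)) (H_sub K H Y)
    \<subseteq> localized_subgroup p (on_obj H (base K)) (H_sub K H X)"
proof -
  have Z: "Z \<in> V" and f: "gen_finite_of_degree K Z Y f d" and g: "proper_mor K Z X g"
    using corr by (auto simp: is_correspondence_def)
  have f': "proper_mor K Z Y f" using f by (simp add: gen_finite_of_degree_def)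
  have YV: "Y \<in> V" using Reg Y by blast
  \<comment> \<open>If \<open>d\<close> were 0, coprimality would force
    \<open>p = 1\<close>.\<close>
  have "d > 0"
    using d p by (intro gr0I) (auto simp: prime_nat_iff)
  interpret hom_y: group_hom "on_obj H Y" "on_obj H (base K)" "on_mor H Y (base K) (str Y)"
    using group_hom_on_mor[OF H YV K proper_mor_structural[OF cY]] .
  interpret hom_g: group_hom "on_obj H Z" "on_obj H X" "on_mor H Z X g"
    using group_hom_on_mor[OF H Z X g] .
  show ?thesis
  proof (rule localized_subgroup_mono)
    show "group (on_obj H (base K))" by (rule hom_y.H.is_group)
    show "subgroup (H_sub K H Y) (on_obj H (base K))" "subgroup (H_sub K H X) (on_obj H (base K))"
      using subgroup_H_sub[OF H K] YV X cX cY by auto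
  next
    fix s assume "s \<in> H_sub K H Y"
    then obtain h where h: "h \<in> carrier (on_obj H Y)" "s = on_mor H Y (base K) (str Y) h"
      by (auto simp: H_sub_def)
    obtain n z where z: "z \<in> carrier (on_obj H Z)" "h [^]\<^bsub>on_obj H Y\<^esub> (d ^ n) = on_mor H Z Y f z"
      using pow_in_range_of_push_forward[OF RH R H Reg Z Y f h(1)] by blast
    have "s [^]\<^bsub>on_obj H (base K)\<^esub> (d ^ n) = on_mor H Y (base K) (str Y) (on_mor H Z Y f z)"
      using h by (simp add: hom_y.hom_nat_pow z(2)[symmetric])
    \<comment> \<open>Both sides are the push-forward of \<open>z\<close> along
      \<open>str Z\<close>.\<close>
    also have "\<dots> = on_mor H X (base K) (str X) (on_mor H Z X g z)"
      using on_mor_str[OF H K Z YV cY f' z(1)] on_mor_str[OF H K Z X cX g z(1)] by simp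
    finally have "s [^]\<^bsub>on_obj H (base K)\<^esub> (d ^ n) \<in> H_sub K H X"
      using z(1) by (simp add: H_sub_def)
    then show "\<exists>m. m > 0 \<and> coprime m p \<and> s [^]\<^bsub>on_obj H (base K)\<^esub> (m::nat) \<in> H_sub K H X"
      using \<open>d > 0\<close> d by (intro exI[of _ "d ^ n"]) auto
  qed
qed

theorem corollary4p3:
  fixes k :: "'u ring" and K :: "'u space" and V Reg :: "'u scheme_over set"
    and R :: "('u, 'r) functor_data" and H :: "('u, 'h) functor_data"
    and p :: nat and X Y :: "'u scheme_over"
  assumes "infinite (UNIV :: 'u set)"
    and "is_Spec_field k K"
    and "\<forall>Z \<in> V. variety K Z"
    and "base K \<in> V"
    and "Reg = {Z \<in> V. regular Z} \<or> Reg = {Z \<in> V. smooth K Z}"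
    and "functor_to_Ab K V R"
    and "functor_to_Ab K V H"
    and "satisfies_R_H K V Reg R H"
    and "prime p"
    and "Y \<in> Reg" and "X \<in> Reg"
    and "complete_over K Y" and "complete_over K X"
    and "p_equivalent K V p X Y"
  shows "localized_subgroup p (on_obj H (base K)) (H_sub K H Y)
       = localized_subgroup p (on_obj H (base K)) (H_sub K H X)"
proof -
  have Reg: "Reg \<subseteq> V" using assms(5) by auto
  note mono = localized_H_sub_mono[OF assms(8,6,7) Reg assms(4)]
  have "X \<in> V" "Y \<in> V" using Reg assms(10,11) by auto
  from assms(14) obtain Z f g d Z' f' g' d' where
    YX: "is_correspondence K V Y X Z f g d" "coprime d p" and
    XY: "is_correspondence K V X Y Z' f' g' d'" "coprime d' p"
    unfolding p_equivalent_def by (elim conjE exE) rule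
  \<comment> \<open>The two directions give the two inclusions; both varieties lie in
    \<open>Reg\<close>, so each can be the target of the generically finite leg.\<close>
  show ?thesis
    using mono[OF assms(10) \<open>X \<in> V\<close> assms(12,13) YX assms(9)]
      mono[OF assms(11) \<open>Y \<in> V\<close> assms(13,12) XY assms(9)]
    by (rule equalityI)
qed

end
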